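(* Let $\lambda,\theta$ be cardinals, and for each $i\in\theta$ let $\kappa_i,\lambda_i$ be cardinals, $\mathscr{D}_i$ a filter and $c_i$ a function, and let $\bar\eta=(\eta_\alpha\mid\alpha\in\lambda^+)$, such that: (A) $\lambda>\mathrm{cf}(\lambda)=\theta$; $\lambda=\bigcup_{i\in\theta}\kappa_i=\bigcup_{i\in\theta}\lambda_i$; $\kappa_i=\mathrm{cf}(\kappa_i)<\lambda_i=\mathrm{cf}(\lambda_i)$ and $\lambda_i^{<\kappa_i}=\lambda_i$ for every $i\in\theta$; and $\prod_{i<j}\lambda_i<\kappa_j$ for every $j\in\theta$. (B) For every $i\in\theta$: $\mathscr{D}_i$ is a $\kappa_i$-complete proper filter over $\lambda_i$; $c_i:[\lambda_i]^2\to\{0,1\}$; if $A\subseteq\lambda_i$ and $c_i''[A]^2=\{0\}$ then $A=\varnothing\bmod\mathscr{D}_i$ (i.e., $\lambda_i\setminus A\in\mathscr{D}_i$); and if $\alpha<\beta<\gamma<\lambda_i$ and $\varepsilon=c_i(\{\alpha,\beta\})=c_i(\{\alpha,\gamma\})=c_i(\{\beta,\gamma\})$ then $\varepsilon=0$. (C) $\bar\eta\subseteq\prod_{i\in\theta}\lambda_i$; if $\alpha<\beta<\lambda^+$ then $\eta_\alpha\neq\eta_\beta$; and if $A_i\in\mathscr{D}_i$ for every $i\in\theta$ then there is $\alpha_0\in\lambda^+$ such that for every $\alpha$ with $\alpha_0\le\alpha<\lambda^+$ there is $i_\alpha\in\theta$ with $\eta_\alpha(i)\in A_i$ whenever $i_\alpha\le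 i<\theta$. Then $\lambda^+\nrightarrow(\lambda^+,(3)_\theta)^2$.
   Context: For cardinals $\kappa\le\lambda$ and $\theta$, the relation $\lambda\rightarrow(\kappa,(3)_\theta)^2$ means: for every coloring $c:[\lambda]^2\to\theta$ there is either $A\in[\lambda]^\kappa$ with $c''[A]^2=\{0\}$, or $B\in[\lambda]^3$ and $\gamma\in(0,\theta)$ with $c''[B]^2=\{\gamma\}$; $\nrightarrow$ denotes its negation. *)

theory Defs
  imports Main "HOL-Library.Ramsey" "HOL-Library.FuncSet"
begin

unbundle cardinal_syntax

(* A cardinal is a relation r with Card_order r.  An element a of Field r plays the role of an
   ordinal a < r: as a set it is underS r a, so "b \<in> underS r a" reads "b < a", and as an
   order type it is Restr r (underS r a). *)

text \<open>
  Unboundedness is meant in the non-strict sense, so that cf 0 = 0 and the cofinality of a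
  successor is 1; the library's \<^const>\<open>cofinal\<close> is strict, and makes every finite
  cardinal vacuously regular.
\<close>

definition unbounded_in :: "'a set \<Rightarrow> 'a rel \<Rightarrow> bool" where
  "unbounded_in X r \<longleftrightarrow> X \<subseteq> Field r \<and> (\<forall>a\<in>Field r. \<exists>b\<in>X. (a, b) \<in> r)"

definition cf :: "'a rel \<Rightarrow> 'a rel" where
  "cf r = |SOME X. unbounded_in X r \<and> (\<forall>Y. unbounded_in Y r \<longrightarrow> |X| \<le>o |Y| )|"

lemma cf_witness:
  assumes "Card_order r"
  shows "\<exists>X. unbounded_in X r \<and> cf r = |X| \<and> (\<forall>Y. unbounded_in Y r \<longrightarrow> |X| \<le>o |Y| )"
proof -
  have "refl_on (Field r) r"
    using assms by (simp add: card_order_on_def order_on_defs)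
  then have "unbounded_in (Field r) r"
    by (auto simp: unbounded_in_def refl_on_def)
  then have "\<exists>s \<in> {|X| |X. unbounded_in X r}. \<forall>t \<in> {|X| |X. unbounded_in X r}. s \<le>o t"
    by (intro exists_minim_Card_order) (auto simp: card_of_Card_order)
  then have "\<exists>X. unbounded_in X r \<and> (\<forall>Y. unbounded_in Y r \<longrightarrow> |X| \<le>o |Y| )"
    by blast
  from someI_ex[OF this] show ?thesis
    unfolding cf_def by blast
qed

text \<open>
  The equation \<open>L = (\<Union>i\<in>I. k i)\<close> between von Neumann ordinals, up to order isomorphism: each
  \<open>k i\<close> is at most \<open>L\<close>, and each ordinal \<open>a < L\<close> satisfies \<open>a < k i\<close> for some \<open>i\<close>.
\<close>

definition is_ordinal_union :: "'a rel \<Rightarrow> 'i set \<Rightarrow> ('i \<Rightarrow> 'k rel) \<Rightarrow> bool" where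
  "is_ordinal_union L I k \<longleftrightarrow>
     (\<forall>i\<in>I. k i \<le>o L) \<and>
     (\<forall>a\<in>Field L. \<exists>i\<in>I. Restr L (underS L a) <o k i)"

text \<open>
  The cardinal power \<open>L\<^sup><\<^sup>k\<close> as the number of functions into \<open>L\<close> whose domain is an ordinal
  below \<open>k\<close>; partial maps keep functions with different domains distinct.
\<close>

definition cpow_less :: "'l rel \<Rightarrow> 'k rel \<Rightarrow> ('k \<Rightarrow> 'l option) rel" where
  "cpow_less L k = |{f. (\<exists>a\<in>Field k. dom f = underS k a) \<and> ran f \<subseteq> Field L}|"

text \<open>
  A filter over a set \<open>S\<close> is a library filter \<open>D\<close> with \<open>D \<le> principal S\<close>; its members are the
  \<open>A \<subseteq> S\<close> with \<open>\<forall>\<^sub>F x in D. x \<in> A\<close>, and it is proper iff \<open>D \<noteq> bot\<close>.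
\<close>

definition complete_filter :: "'k rel \<Rightarrow> 'd filter \<Rightarrow> bool" where
  "complete_filter k D \<longleftrightarrow>
     (\<forall>X :: 'd set set. |X| <o k \<and> (\<forall>A\<in>X. \<forall>\<^sub>F x in D. x \<in> A) \<longrightarrow> (\<forall>\<^sub>F x in D. x \<in> \<Inter>X))"

text \<open>The colour 0 is the least element of the cardinal of colours.\<close>

definition ord_zero :: "'a rel \<Rightarrow> 'a" where
  "ord_zero r = wo_rel.minim r (Field r)"

text \<open>\<open>L \<rightarrow> (k, (3)\<^sub>T)\<^sup>2\<close>\<close>

definition arrows3 :: "'a rel \<Rightarrow> 'k rel \<Rightarrow> 't rel \<Rightarrow> bool" where
  "arrows3 L k T \<longleftrightarrow>
     (\<forall>c \<in> [Field L]\<^bsup>2\<^esup> \<rightarrow> Field T.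
        (\<exists>A. A \<subseteq> Field L \<and> |A| =o k \<and> c ` [A]\<^bsup>2\<^esup> = {ord_zero T}) \<or>
        (\<exists>B \<in> [Field L]\<^bsup>3\<^esup>. \<exists>g \<in> Field T - {ord_zero T}. c ` [B]\<^bsup>2\<^esup> = {g}))"

end

theory Submission
  imports Defs
begin

text \<open>
  Colour \<open>{\<alpha>, \<beta>}\<close> by looking at the first \<open>j\<close> where \<open>\<eta>\<^sub>\<alpha>\<close> and \<open>\<eta>\<^sub>\<beta>\<close> differ: the colour is 0 if
  \<open>c\<^sub>j\<close> gives 0 to the two values there, and otherwise a nonzero colour coding \<open>j\<close>. A triangle
  of nonzero colour would be a triangle of colour 1 for \<open>c\<^sub>j\<close>. If \<open>A\<close> is homogeneous of colour 0,
  then at each node \<open>s \<in> \<Prod>\<^sub>i\<^sub><\<^sub>j \<lambda>\<^sub>i\<close> where the tree of the \<open>\<eta>\<^sub>\<alpha>\<close> with \<open>\<alpha> \<in> A\<close> splits, the set of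
  successors is null for \<open>\<D>\<^sub>j\<close>; there are fewer than \<open>\<kappa>\<^sub>j\<close> nodes, so almost all points of \<open>\<lambda>\<^sub>j\<close> avoid all
  these sets. By (C), for all large \<open>\<alpha> \<in> A\<close> the branch \<open>\<eta>\<^sub>\<alpha>\<close> meets no splitting node
  from some level \<open>i\<^sub>\<alpha>\<close> on, hence is determined by its restriction to \<open>i\<^sub>\<alpha>\<close>, and there are only
  \<open>\<lambda>\<close> such restrictions. Nodes with a single successor are not claimed to be null: the
  hypothesis on null sets says nothing about singletons.
\<close>

text \<open>A finite nonempty subset of a linear order has a largest element, and unboundedness in
  the non-strict sense makes that element the maximum of \<open>L\<close>. Applied to a witness of
  \<open>cf L\<close>, this begins the argument that there are infinitely many colours.\<close>

lemma finite_cf_imp_max: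
  assumes L: "Card_order L" and fin: "finite (Field (cf L))" and ne: "Field L \<noteq> {}"
  shows "\<exists>m\<in>Field L. \<forall>a\<in>Field L. (a, m) \<in> L"
proof -
  have wo: "wo_rel L"
    using L by (simp add: card_order_on_well_order_on wo_rel_def)
  obtain X where X: "unbounded_in X L" "cf L = |X|"
    using cf_witness[OF L] by blast
  have finX: "finite X" using fin X(2) by (simp add: Field_card_of)
  have neX: "X \<noteq> {}" and XL: "X \<subseteq> Field L" using X(1) ne by (auto simp: unbounded_in_def)
  have "\<exists>m\<in>X. \<forall>a\<in>X. (a, m) \<in> L"
    using finX neX XL
  proof (induction X rule: finite_ne_induct)
    case (singleton x)
    then show ?case using wo_rel.REFL[OF wo] by (auto simp: refl_on_def)
  next
    case (insert x F)
    then obtain m where m: "m \<in> F" "\<forall>a\<in>F. (a, m) \<in> L" by auto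
    have "(x, m) \<in> L \<or> (m, x) \<in> L"
      using wo_rel.TOTALS[OF wo] insert.prems m(1) by blast
    moreover have "(x, x) \<in> L" using wo_rel.REFL[OF wo] insert.prems by (auto simp: refl_on_def)
    moreover have "(a, x) \<in> L" if "a \<in> F" "(m, x) \<in> L" for a
      using m(2) that wo_rel.TRANS[OF wo] by (meson transD)
    ultimately show ?case using m by blast
  qed
  then show ?thesis
    using X(1) wo_rel.TRANS[OF wo] unfolding unbounded_in_def
    by (meson subsetD transD)
qed

text \<open>Adding the single point \<open>m\<close> to \<open>underS L m\<close> gives all of
  \<open>L\<close>, and no cardinal lies strictly between the size of a set and that of the set with
  one more point, be it finite or infinite.\<close>

lemma no_cardinal_between_max_segment:
  assumes L: "Card_order L" and k: "Card_order k"
    and m: "m \<in> Field L" "\<forall>a\<in>Field L. (a, m) \<in> L"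
    and less: "Restr L (underS L m) <o k"
  shows "\<not> k <o L"
proof
  assume kL: "k <o L"
  let ?U = "underS L m"
  have wo: "Well_order L" using L by (rule card_order_on_well_order_on)
  have F: "Field L = insert m ?U"
    using m by (auto simp: underS_def Field_def)
  have "well_order_on ?U (Restr L ?U)"
    using wo by (metis F Well_order_Restr well_order_on_Well_order subset_insertI well_order_on_Restr)
  then have "|?U| \<le>o Restr L ?U" by (rule card_of_least)
  then have Uk: "|?U| <o k" using less by (rule ordLeq_ordLess_trans)
  have "L =o |insert m ?U|" using card_of_unique[of "Field L" L] L F by simp
  then have kI: "k <o |insert m ?U|" using kL by (rule ordLess_ordIso_trans[rotated])
  have kF: "k =o |Field k|" using k by (simp add: card_of_Field_ordIso ordIso_symmetric)
  have UF: "|?U| <o |Field k|" using Uk kF by (rule ordLess_ordIso_trans)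
  have FI: "|Field k| <o |insert m ?U|" using ordIso_symmetric[OF kF] kI by (rule ordIso_ordLess_trans)
  obtain f where f: "inj_on f ?U" "f ` ?U \<subseteq> Field k"
    using ordLess_imp_ordLeq[OF UF] card_of_ordLeq[of ?U "Field k"] by blast
  have "f ` ?U \<noteq> Field k"
  proof
    assume "f ` ?U = Field k"
    then have "|Field k| \<le>o |?U|" using card_of_image[of f ?U] by simp
    then show False using UF by (simp add: not_ordLess_ordLeq)
  qed
  \<comment> \<open>A value missed by \<open>f\<close> is free to serve as the image of
    \<open>m\<close>, so that all of \<open>L\<close> injects into \<open>k\<close>.\<close>
  then obtain y where y: "y \<in> Field k" "y \<notin> f ` ?U" using f(2) by blast
  have "inj_on (f(m := y)) (insert m ?U)"
    using f(1) y(2) by (auto simp: inj_on_def underS_def)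
  moreover have "f(m := y) ` insert m ?U \<subseteq> Field k" using f(2) y(1) by auto
  ultimately have "|insert m ?U| \<le>o |Field k|" using card_of_ordLeq by blast
  then show False using FI by (simp add: not_ordLess_ordLeq)
qed

theorem theorem3p2:
  fixes L :: "'a rel" and T :: "'i rel"
    and kap :: "'i \<Rightarrow> 'k rel" and lam :: "'i \<Rightarrow> 'd rel"
    and D :: "'i \<Rightarrow> 'd filter"
    and c :: "'i \<Rightarrow> 'd set \<Rightarrow> nat"
    and eta :: "'a set \<Rightarrow> 'i \<Rightarrow> 'd"
  assumes card_L: "Card_order L"
    and card_T: "Card_order T"
    and card_kap: "\<And>i. i \<in> Field T \<Longrightarrow> Card_order (kap i)"
    and card_lam: "\<And>i. i \<in> Field T \<Longrightarrow> Card_order (lam i)"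
    and A_singular: "cf L <o L"
    and A_cf: "cf L =o T"
    and A_union_kap: "is_ordinal_union L (Field T) kap"
    and A_union_lam: "is_ordinal_union L (Field T) lam"
    and A_kap_regular: "\<And>i. i \<in> Field T \<Longrightarrow> kap i =o cf (kap i)"
    and A_kap_lam: "\<And>i. i \<in> Field T \<Longrightarrow> kap i <o lam i"
    and A_lam_regular: "\<And>i. i \<in> Field T \<Longrightarrow> lam i =o cf (lam i)"
    and A_power: "\<And>i. i \<in> Field T \<Longrightarrow> cpow_less (lam i) (kap i) =o lam i"
    and A_product: "\<And>j. j \<in> Field T \<Longrightarrow>
          |\<Pi>\<^sub>E i\<in>underS T j. Field (lam i)| <o kap j"
    and B_filter: "\<And>i. i \<in> Field T \<Longrightarrow>
          D i \<le> principal (Field (lam i)) \<and> D i \<noteq> bot \<and> complete_filter (kap i) (D i)"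
    and B_colour: "\<And>i. i \<in> Field T \<Longrightarrow> c i \<in> [Field (lam i)]\<^bsup>2\<^esup> \<rightarrow> {0, 1}"
    and B_null: "\<And>i A. i \<in> Field T \<Longrightarrow> A \<subseteq> Field (lam i) \<Longrightarrow> c i ` [A]\<^bsup>2\<^esup> = {0} \<Longrightarrow>
          \<forall>\<^sub>F x in D i. x \<in> Field (lam i) - A"
    and B_triangle: "\<And>i x y z e. i \<in> Field T \<Longrightarrow> z \<in> Field (lam i) \<Longrightarrow>
          x \<in> underS (lam i) y \<Longrightarrow> y \<in> underS (lam i) z \<Longrightarrow>
          e = c i {x, y} \<Longrightarrow> e = c i {x, z} \<Longrightarrow> e = c i {y, z} \<Longrightarrow> e = 0"
    and C_product: "\<And>\<alpha>. \<alpha> \<in> Field (cardSuc L) \<Longrightarrow>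
          eta \<alpha> \<in> (\<Pi>\<^sub>E i\<in>Field T. Field (lam i))"
    and C_distinct: "\<And>\<alpha> \<beta>. \<beta> \<in> Field (cardSuc L) \<Longrightarrow> \<alpha> \<in> underS (cardSuc L) \<beta> \<Longrightarrow>
          eta \<alpha> \<noteq> eta \<beta>"
    and C_scale: "\<And>A. (\<And>i. i \<in> Field T \<Longrightarrow>
            A i \<subseteq> Field (lam i) \<and> (\<forall>\<^sub>F x in D i. x \<in> A i)) \<Longrightarrow>
          \<exists>\<alpha>\<^sub>0 \<in> Field (cardSuc L). \<forall>\<alpha>. (\<alpha>\<^sub>0, \<alpha>) \<in> cardSuc L \<longrightarrow>
            (\<exists>i\<^sub>\<alpha> \<in> Field T. \<forall>i. (i\<^sub>\<alpha>, i) \<in> T \<longrightarrow> eta \<alpha> i \<in> A i)"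
  shows "\<not> arrows3 (cardSuc L) (cardSuc L) T"
proof
  assume arrows: "arrows3 (cardSuc L) (cardSuc L) T"
  let ?K = "cardSuc L"
  have woT: "wo_rel T"
    using card_T by (simp add: card_order_on_well_order_on wo_rel_def)
  have cardK: "Card_order ?K" using card_L by (rule cardSuc_Card_order)
  have woK: "wo_rel ?K"
    using cardK by (simp add: card_order_on_well_order_on wo_rel_def)

  \<comment> \<open>Infinitely many colours\<close>
  have infT: "infinite (Field T)"
  proof
    assume "finite (Field T)"
    moreover have "|Field (cf L)| \<le>o |Field T|"
      using A_cf by (meson card_of_mono2 ordIso_imp_ordLeq)
    ultimately have fin: "finite (Field (cf L))" by (meson card_of_ordLeq_finite)
    have "Field L \<noteq> {}"
    proof
      assume "Field L = {}"
      then have "L =o |{} :: 'a set|" using card_of_Field_ordIso[OF card_L] by (simp add: ordIso_symmetric)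
      then have "L \<le>o |Field (cf L)|" using card_of_empty by (rule ordIso_ordLeq_trans)
      then show False using ordLess_Field[OF A_singular] by (simp add: not_ordLess_ordLeq)
    qed
    then obtain m where m: "m \<in> Field L" "\<forall>a\<in>Field L. (a, m) \<in> L"
      using finite_cf_imp_max[OF card_L fin] by blast
    \<comment> \<open>Some \<open>kap i\<close> exceeds the segment below the maximum
      \<open>m\<close>, yet (A) gives \<open>kap i <o lam i\<close> and
      \<open>lam i \<le>o L\<close>.\<close>
    obtain i where i: "i \<in> Field T" "Restr L (underS L m) <o kap i"
      using A_union_kap m(1) by (auto simp: is_ordinal_union_def)
    have "kap i <o L"
      using A_kap_lam[OF i(1)] A_union_lam i(1) unfolding is_ordinal_union_def
      by (meson ordLess_ordLeq_trans)
    then show False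
      using no_cardinal_between_max_segment[OF card_L card_kap[OF i(1)] m i(2)] by blast
  qed
  have "|Field T| \<le>o cf L"
    using card_of_Field_ordIso[OF card_T] ordIso_symmetric[OF A_cf]
    by (rule ordIso_imp_ordLeq[OF ordIso_transitive])
  then have TL: "|Field T| <o L" using A_singular by (rule ordLeq_ordLess_trans)
  have infL: "infinite (Field L)"
    using card_of_ordLeq_infinite[OF _ infT] card_of_mono2[OF ordLess_imp_ordLeq[OF TL]]
    by (simp add: Field_card_of)

  \<comment> \<open>Infinity of \<open>T\<close> is what lets all levels be coded injectively by
    colours other than 0.\<close>
  obtain code where "bij_betw code (Field T) (Field T - {ord_zero T})"
    using infinite_imp_bij_betw[OF infT] by blast
  then have code_inj: "inj_on code (Field T)"
    and code_in: "\<And>i. i \<in> Field T \<Longrightarrow> code i \<in> Field T - {ord_zero T}"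
    by (auto simp: bij_betw_def)
  have zero_in: "ord_zero T \<in> Field T"
    unfolding ord_zero_def using infT by (intro wo_rel.minim_in[OF woT]) auto

  \<comment> \<open>The colouring by splitting level\<close>
  define \<Delta> where "\<Delta> X = wo_rel.minim T {i \<in> Field T. \<exists>a\<in>X. \<exists>b\<in>X. eta a i \<noteq> eta b i}" for X
  have \<Delta>: "\<Delta> {a, b} \<in> Field T" "eta a (\<Delta> {a, b}) \<noteq> eta b (\<Delta> {a, b})"
      "\<And>i. i \<in> underS T (\<Delta> {a, b}) \<Longrightarrow> eta a i = eta b i"
    if ab: "a \<in> Field ?K" "b \<in> Field ?K" "a \<noteq> b" for a b
  proof -
    let ?S = "{i \<in> Field T. \<exists>x\<in>{a, b}. \<exists>y\<in>{a, b}. eta x i \<noteq> eta y i}"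
    have "(a, b) \<in> ?K \<or> (b, a) \<in> ?K" using wo_rel.TOTALS[OF woK] ab by blast
    then have "eta a \<noteq> eta b"
      using C_distinct[of b a] C_distinct[of a b] ab by (auto simp: underS_def)
    then obtain i where "i \<in> Field T" "eta a i \<noteq> eta b i"
      using PiE_ext[OF C_product[OF ab(1)] C_product[OF ab(2)]] by blast
    then have ne: "?S \<noteq> {}" by auto
    have sub: "?S \<subseteq> Field T" by blast
    have "\<Delta> {a, b} \<in> ?S"
      unfolding \<Delta>_def by (rule wo_rel.minim_in[OF woT sub ne])
    then show "\<Delta> {a, b} \<in> Field T" "eta a (\<Delta> {a, b}) \<noteq> eta b (\<Delta> {a, b})" by auto
    fix i assume i: "i \<in> underS T (\<Delta> {a, b})"
    then have iT: "i \<in> Field T" by (auto simp: underS_def Field_def)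
    show "eta a i = eta b i"
    proof (rule ccontr)
      assume "eta a i \<noteq> eta b i"
      then have "i \<in> ?S" using iT by blast
      then have "(\<Delta> {a, b}, i) \<in> T"
        unfolding \<Delta>_def by (rule wo_rel.minim_least[OF woT sub])
      then show False
        using i wo_rel.ANTISYM[OF woT] by (auto simp: underS_def antisym_def)
    qed
  qed

  \<comment> \<open>For \<open>X = {a, b}\<close> the image is the set of the two values at the
    level where the branches split; they differ there, so \<open>c (\<Delta> X)\<close> is applied
    to a genuine pair.\<close>
  define col where
    "col X = (if c (\<Delta> X) ((\<lambda>a. eta a (\<Delta> X)) ` X) = 0 then ord_zero T else code (\<Delta> X))" for X
  have eta_in: "eta a i \<in> Field (lam i)" if "a \<in> Field ?K" "i \<in> Field T" for a i
    using C_product[OF that(1)] that(2) by (rule PiE_mem)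
  have colF: "col \<in> [Field ?K]\<^bsup>2\<^esup> \<rightarrow> Field T"
  proof
    fix X assume "X \<in> [Field ?K]\<^bsup>2\<^esup>"
    then obtain a b where "X = {a, b}" "a \<in> Field ?K" "b \<in> Field ?K" "a \<noteq> b"
      by (auto simp: nsets_def card_2_iff)
    then show "col X \<in> Field T"
      using \<Delta>(1)[of a b] code_in zero_in by (simp add: col_def)
  qed
  consider
      (big) A where "A \<subseteq> Field ?K" "|A| =o ?K" "col ` [A]\<^bsup>2\<^esup> = {ord_zero T}"
    | (tri) B g where "B \<in> [Field ?K]\<^bsup>3\<^esup>" "g \<in> Field T - {ord_zero T}" "col ` [B]\<^bsup>2\<^esup> = {g}"
    using bspec[OF arrows[unfolded arrows3_def] colF] by (elim disjE exE bexE conjE) blast+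
  then show False
  proof cases

    \<comment> \<open>No triangle of nonzero colour\<close>
    case tri
    obtain a b d where B: "B = {a, b, d}" "a \<noteq> b" "a \<noteq> d" "b \<noteq> d"
      and BK: "a \<in> Field ?K" "b \<in> Field ?K" "d \<in> Field ?K"
      using tri(1) by (auto simp: nsets_def card_3_iff)
    have nz: "code (\<Delta> {x, y}) = g \<and> c (\<Delta> {x, y}) {eta x (\<Delta> {x, y}), eta y (\<Delta> {x, y})} \<noteq> 0"
      if "x \<in> B" "y \<in> B" "x \<noteq> y" for x y
    proof -
      have "{x, y} \<in> [B]\<^bsup>2\<^esup>" using that by (auto simp: nsets_def)
      then have "col {x, y} = g" using tri(3) by blast
      then show ?thesis using tri(2) by (auto simp: col_def split: if_splits)
    qed
    define j where "j = \<Delta> {a, b}"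
    have BF: "x \<in> Field ?K" if "x \<in> B" for x using that B BK by auto
    have jT: "j \<in> Field T" using \<Delta>(1) BK B by (auto simp: j_def)
    \<comment> \<open>Pairs of the same nonzero colour have the same code, so by injectivity of
      \<open>code\<close> all sides of the triangle split at one level.\<close>
    have j: "\<Delta> {x, y} = j" if xy: "x \<in> B" "y \<in> B" "x \<noteq> y" for x y
    proof -
      have "code (\<Delta> {x, y}) = code j"
        using nz[OF xy] nz[of a b] B by (simp add: j_def)
      then show ?thesis
        using code_inj jT \<Delta>(1)[OF BF[OF xy(1)] BF[OF xy(2)] xy(3)] by (auto dest: inj_onD)
    qed
    define h where "h x = eta x j" for x
    have hF: "h x \<in> Field (lam j)" if "x \<in> B" for x
      using eta_in[OF BF[OF that] jT] by (simp add: h_def)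
    have h_ne: "h x \<noteq> h y" if "x \<in> B" "y \<in> B" "x \<noteq> y" for x y
      using \<Delta>(2)[OF BF BF that(3)] that j[OF that] by (simp add: h_def)
    have c1: "c j {h x, h y} = 1" if xy: "x \<in> B" "y \<in> B" "x \<noteq> y" for x y
    proof -
      have "{h x, h y} \<in> [Field (lam j)]\<^bsup>2\<^esup>"
        using hF xy h_ne[OF xy] by (auto simp: nsets_def)
      then have "c j {h x, h y} \<in> {0, 1}" using B_colour[OF jT] by blast
      then show ?thesis using nz[OF xy] j[OF xy] by (auto simp: h_def)
    qed
    have wol: "wo_rel (lam j)"
      using card_lam[OF jT] by (simp add: card_order_on_well_order_on wo_rel_def)
    have no_chain: False
      if "x \<in> B" "y \<in> B" "z \<in> B" "x \<noteq> y" "x \<noteq> z" "y \<noteq> z"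
        "(h x, h y) \<in> lam j" "(h y, h z) \<in> lam j" for x y z
    proof -
      have "h x \<in> underS (lam j) (h y)" "h y \<in> underS (lam j) (h z)"
        using that h_ne by (auto simp: underS_def)
      then show False
        using B_triangle[OF jT hF[OF that(3)], of "h x" "h y" 1] c1 that by simp
    qed
    have tot: "(h x, h y) \<in> lam j \<or> (h y, h x) \<in> lam j" if "x \<in> B" "y \<in> B" for x y
      using wo_rel.TOTALS[OF wol] hF that by blast
    \<comment> \<open>The values at \<open>j\<close> are pairwise distinct, so by totality some
      arrangement of \<open>a\<close>, \<open>b\<close>, \<open>d\<close> makes them an increasing
      chain in \<open>lam j\<close>.\<close>
    have "a \<in> B" "b \<in> B" "d \<in> B" using B by auto
    then show False
      using no_chain tot B(2-4) by metis
  next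

    \<comment> \<open>No large set of colour 0\<close>
    case big
    have col0: "c (\<Delta> {a, b}) {eta a (\<Delta> {a, b}), eta b (\<Delta> {a, b})} = 0"
      if "a \<in> A" "b \<in> A" "a \<noteq> b" for a b
    proof -
      have "{a, b} \<in> [A]\<^bsup>2\<^esup>" using that by (auto simp: nsets_def)
      then have "col {a, b} = ord_zero T" using big(3) by blast
      moreover have "\<Delta> {a, b} \<in> Field T" using \<Delta>(1) that big(1) by blast
      ultimately show ?thesis using code_in by (auto simp: col_def split: if_splits)
    qed

    \<comment> \<open>The branches from \<open>A\<close> form a tree: \<open>P j\<close> contains
      its nodes of level \<open>j\<close>, \<open>succs j s\<close> is the set of immediate
      successors of \<open>s\<close>, and \<open>s\<close> splits when this set has two elements. In
      \<open>G\<close>, the intersection with \<open>Field (lam j)\<close> matters if no node of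
      level \<open>j\<close> splits, since the inner intersection is then the whole type.\<close>
    define succs where
      "succs j s = {eta a j |a. a \<in> A \<and> restrict (eta a) (underS T j) = s}" for j s
    define P where "P j = (\<Pi>\<^sub>E i\<in>underS T j. Field (lam i))" for j
    define G where
      "G j = Field (lam j) \<inter>
         \<Inter> ((\<lambda>s. Field (lam j) - succs j s) ` {s \<in> P j. [succs j s]\<^bsup>2\<^esup> \<noteq> {}})" for j
    have underS_T: "i \<in> Field T" if "i \<in> underS T j" for i j
      using that by (auto simp: underS_def Field_def)
    have restr_in: "restrict (eta a) (underS T j) \<in> P j" if "a \<in> Field ?K" for a j
      unfolding P_def using eta_in[OF that] underS_T by (auto intro!: restrict_PiE_iff[THEN iffD2])
    have null: "\<forall>\<^sub>F x in D j. x \<in> Field (lam j) - succs j s"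
      if jT: "j \<in> Field T" and ne: "[succs j s]\<^bsup>2\<^esup> \<noteq> {}" for j s
    proof (rule B_null[OF jT])
      show "succs j s \<subseteq> Field (lam j)"
        using eta_in jT big(1) by (auto simp: succs_def)
      \<comment> \<open>Two different successors of \<open>s\<close> come from branches that agree
        below \<open>j\<close> and differ at \<open>j\<close>, so colour 0 on \<open>A\<close> is a
        statement about \<open>c j\<close>.\<close>
      have "c j Y = 0" if Y2: "Y \<in> [succs j s]\<^bsup>2\<^esup>" for Y
      proof -
        obtain x y where Y: "Y = {x, y}" "x \<noteq> y" "x \<in> succs j s" "y \<in> succs j s"
          using Y2 by (auto simp: nsets_def card_2_iff)
        obtain a b where ab: "a \<in> A" "b \<in> A" "x = eta a j" "y = eta b j"
            "restrict (eta a) (underS T j) = s" "restrict (eta b) (underS T j) = s"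
          using Y(3,4) by (auto simp: succs_def)
        have "a \<noteq> b" using ab Y(2) by blast
        have aK: "a \<in> Field ?K" "b \<in> Field ?K" using ab big(1) by auto
        have agree: "eta a i = eta b i" if "i \<in> underS T j" for i
          using ab(5,6) that by (metis restrict_apply')
        note \<Delta>ab = \<Delta>[OF aK \<open>a \<noteq> b\<close>]
        have "(j, \<Delta> {a, b}) \<in> T \<or> (\<Delta> {a, b}, j) \<in> T"
          using wo_rel.TOTALS[OF woT] jT \<Delta>ab(1) by blast
        then have "\<Delta> {a, b} = j"
          using agree[of "\<Delta> {a, b}"] \<Delta>ab(2) \<Delta>ab(3)[of j] ab Y(2) by (auto simp: underS_def)
        then show "c j Y = 0" using col0[OF ab(1,2) \<open>a \<noteq> b\<close>] ab Y(1) by simp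
      qed
      \<comment> \<open>Splitting makes the image exactly \<open>{0}\<close> rather than
        empty.\<close>
      then show "c j ` [succs j s]\<^bsup>2\<^esup> = {0}" using ne by (auto simp: image_iff)
    qed
    have G: "G j \<subseteq> Field (lam j) \<and> (\<forall>\<^sub>F x in D j. x \<in> G j)" if jT: "j \<in> Field T" for j
    proof
      show "G j \<subseteq> Field (lam j)" by (auto simp: G_def)
      let ?X = "(\<lambda>s. Field (lam j) - succs j s) ` {s \<in> P j. [succs j s]\<^bsup>2\<^esup> \<noteq> {}}"
      have "|?X| \<le>o |P j|"
        by (rule ordLeq_transitive[OF card_of_image card_of_mono1]) blast
      then have "|?X| <o kap j"
        using A_product[OF jT] unfolding P_def by (rule ordLeq_ordLess_trans)
      moreover have "\<forall>Y\<in>?X. \<forall>\<^sub>F x in D j. x \<in> Y" using null[OF jT] by blast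
      ultimately have "\<forall>\<^sub>F x in D j. x \<in> \<Inter> ?X"
        using B_filter[OF jT] unfolding complete_filter_def by blast
      moreover have "\<forall>\<^sub>F x in D j. x \<in> Field (lam j)"
        using B_filter[OF jT] by (simp add: le_principal)
      ultimately show "\<forall>\<^sub>F x in D j. x \<in> G j"
        unfolding G_def by (rule eventually_elim2) (rule IntI)
    qed
    obtain \<alpha>\<^sub>0 where \<alpha>\<^sub>0: "\<alpha>\<^sub>0 \<in> Field ?K"
      and "\<forall>a. (\<alpha>\<^sub>0, a) \<in> ?K \<longrightarrow> (\<exists>k\<in>Field T. \<forall>i. (k, i) \<in> T \<longrightarrow> eta a i \<in> G i)"
      using C_scale[of G] G by blast
    then obtain lev where lev: "\<And>a. (\<alpha>\<^sub>0, a) \<in> ?K \<Longrightarrow> lev a \<in> Field T"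
        "\<And>a i. (\<alpha>\<^sub>0, a) \<in> ?K \<Longrightarrow> (lev a, i) \<in> T \<Longrightarrow> eta a i \<in> G i"
      by metis
    define A' where "A' = {a \<in> A. (\<alpha>\<^sub>0, a) \<in> ?K}"
    let ?\<Phi> = "\<lambda>a. (lev a, restrict (eta a) (underS T (lev a)))"
    \<comment> \<open>If two branches had the same label, their splitting level \<open>j\<close>
      would not be below \<open>lev a\<close>, so \<open>eta a j\<close> would lie in
      \<open>G j\<close>; but it is a successor of the node at which they split, and
      \<open>G j\<close> excludes these.\<close>
    have "inj_on ?\<Phi> A'"
    proof (rule inj_onI, rule ccontr)
      fix a b assume "a \<in> A'" "b \<in> A'" and eq: "?\<Phi> a = ?\<Phi> b" and ne: "a \<noteq> b"
      then have ab: "a \<in> A" "b \<in> A" "(\<alpha>\<^sub>0, a) \<in> ?K" by (auto simp: A'_def)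
      have aK: "a \<in> Field ?K" "b \<in> Field ?K" using ab big(1) by auto
      define j where "j = \<Delta> {a, b}"
      note \<Delta>ab = \<Delta>[OF aK ne, folded j_def]
      have agree: "eta a i = eta b i" if "i \<in> underS T (lev a)" for i
        using eq that by (metis prod.inject restrict_apply')
      have "(lev a, j) \<in> T"
      proof (rule ccontr)
        assume *: "(lev a, j) \<notin> T"
        then have "(j, lev a) \<in> T"
          using wo_rel.TOTALS[OF woT] \<Delta>ab(1) lev(1)[OF ab(3)] by blast
        then have "j \<in> underS T (lev a)" using * by (auto simp: underS_def)
        then show False using agree \<Delta>ab(2) by blast
      qed
      then have Ga: "eta a j \<in> G j" using lev(2) ab(3) by blast
      let ?s = "restrict (eta a) (underS T j)"
      have "restrict (eta b) (underS T j) = ?s"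
        using \<Delta>ab(3) by (metis restrict_ext)
      then have s: "eta a j \<in> succs j ?s" "eta b j \<in> succs j ?s"
        using ab unfolding succs_def by blast+
      then have "{eta a j, eta b j} \<in> [succs j ?s]\<^bsup>2\<^esup>"
        using \<Delta>ab(2) by (auto simp: nsets_def)
      then have "eta a j \<notin> succs j ?s"
        using Ga restr_in[OF aK(1)] unfolding G_def by blast
      then show False using s by blast
    qed
    moreover have "?\<Phi> ` A' \<subseteq> (SIGMA j:Field T. P j)"
      using lev(1) restr_in big(1) by (auto simp: A'_def)
    ultimately have "|A'| \<le>o |SIGMA j:Field T. P j|" using card_of_ordLeq by blast
    \<comment> \<open>There are fewer than \<open>L\<close> levels with at most \<open>L\<close>
      nodes each, and \<open>L\<close> is infinite.\<close>
    moreover have "|SIGMA j:Field T. P j| \<le>o L"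
    proof (rule card_of_Sigma_ordLeq_infinite_Field[OF infL card_L])
      show "|Field T| \<le>o L" using TL by (rule ordLess_imp_ordLeq)
      show "\<forall>j\<in>Field T. |P j| \<le>o L"
      proof
        fix j assume j: "j \<in> Field T"
        then have "kap j \<le>o L" using A_union_kap by (simp add: is_ordinal_union_def)
        then show "|P j| \<le>o L"
          unfolding P_def using ordLeq_transitive[OF ordLess_imp_ordLeq[OF A_product[OF j]]] by blast
      qed
    qed
    ultimately have A'L: "|A'| \<le>o L" by (rule ordLeq_transitive)
    \<comment> \<open>The members of \<open>A\<close> before \<open>\<alpha>\<^sub>0\<close> are not
      in \<open>A'\<close>, but they lie in a proper initial segment of \<open>cardSuc L\<close>,
      which has size at most \<open>L\<close>.\<close>
    have "|underS ?K \<alpha>\<^sub>0| <o ?K" using cardK \<alpha>\<^sub>0 by (rule card_of_underS)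
    then have uL: "|underS ?K \<alpha>\<^sub>0| \<le>o L"
      using cardSuc_ordLeq_ordLess[OF card_L card_of_Card_order] by blast
    have "A \<subseteq> underS ?K \<alpha>\<^sub>0 \<union> A'"
    proof
      fix a assume a: "a \<in> A"
      then have "a = \<alpha>\<^sub>0 \<or> (a, \<alpha>\<^sub>0) \<in> ?K \<or> (\<alpha>\<^sub>0, a) \<in> ?K" "(\<alpha>\<^sub>0, \<alpha>\<^sub>0) \<in> ?K"
        using wo_rel.TOTALS[OF woK] \<alpha>\<^sub>0 big(1) by blast+
      then show "a \<in> underS ?K \<alpha>\<^sub>0 \<union> A'" using a by (auto simp: A'_def underS_def)
    qed
    then have "|A| \<le>o |underS ?K \<alpha>\<^sub>0 \<union> A'|" by (rule card_of_mono1)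
    moreover have "|underS ?K \<alpha>\<^sub>0 \<union> A'| \<le>o L"
      using card_of_Un_ordLeq_infinite_Field[OF infL uL A'L card_L] .
    ultimately have "|A| \<le>o L" by (rule ordLeq_transitive)
    then have "?K \<le>o L" using big(2) by (meson ordIso_ordLeq_trans ordIso_symmetric)
    then show False
      using cardSuc_greater[OF card_L] by (meson not_ordLess_ordLeq)
  qed
qed

end
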